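(* Let $R$ be a ring, $\sigma$ an endomorphism of $R$ and $\delta$ a $\sigma$-derivation of $R$. Suppose that $R$ is $(\sigma,\delta)$-skew Armendariz and satisfies the condition $(\mathcal{C}_{\sigma})$. Then the following statements are equivalent: (1) $R$ is symmetric; (2) $R$ is $\sigma$-symmetric; (3) $R$ is right $\sigma$-symmetric; (4) $R[x;\sigma,\delta]$ is symmetric.
   Context: Rings are associative with unity, not necessarily commutative. $\sigma$ is a ring endomorphism of $R$. A $\sigma$-derivation is an additive map $\delta:R\to R$ with $\delta(ab)=\sigma(a)\delta(b)+\delta(a)b$ for all $a,b\in R$. The Ore extension $R[x;\sigma,\delta]$ consists of polynomials $\sum a_i x^i$ with coefficients in $R$ written on the left, with usual addition and multiplication determined by $xa=\sigma(a)x+\delta(a)$ for $a\in R$. Condition $(\mathcal{C}_{\sigma})$: whenever $a\sigma(b)=0$ with $a,b\in R$, then $ab=0$. $R$ is $(\sigma,\delta)$-skew Armendariz if for all $p=\sum_{i=0}^{n}a_ix^i$ and $q=\sum_{j=0}^{m}b_jx^j$ in $R[x;\sigma,\delta]$, $pq=0$ implies $a_ix^ib_jx^j=0$ (in $R[x;\sigma,\delta]$) for all $i,j$. A ring $S$ is symmetric if $abc=0$ implies $acb=0$ for all $a,b,c\in S$. $R$ is right (respectively, left) $\sigma$-symmetric if whenever $abc=0$ for $a,b,c\in R$, then $ac\sigma(b)=0$ (respectively, $\sigma(b)ac=0$). $R$ is $\sigma$-symmetric if it is both right and left $\sigma$-symmetric. *)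

theory Defs
  imports "HOL-Algebra.UnivPoly"
begin

definition sigma_derivation ::
    "('a, 'm) ring_scheme \<Rightarrow> ('a \<Rightarrow> 'a) \<Rightarrow> ('a \<Rightarrow> 'a) \<Rightarrow> bool" where
  "sigma_derivation R \<sigma> \<delta> \<longleftrightarrow>
     \<delta> \<in> carrier R \<rightarrow> carrier R \<and>
     (\<forall>a\<in>carrier R. \<forall>b\<in>carrier R. \<delta> (a \<oplus>\<^bsub>R\<^esub> b) = \<delta> a \<oplus>\<^bsub>R\<^esub> \<delta> b) \<and>
     (\<forall>a\<in>carrier R. \<forall>b\<in>carrier R.
        \<delta> (a \<otimes>\<^bsub>R\<^esub> b) = (\<sigma> a \<otimes>\<^bsub>R\<^esub> \<delta> b) \<oplus>\<^bsub>R\<^esub> (\<delta> a \<otimes>\<^bsub>R\<^esub> b))"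

text \<open>
  Left multiplication by the indeterminate, on coefficient sequences: since
  x b = \<sigma>(b) x + \<delta>(b), it sends the sum of the b_j x^j to the sum of the
  \<sigma>(b_j) x^(j+1) + \<delta>(b_j) x^j.
\<close>

definition ore_x_times ::
    "('a, 'm) ring_scheme \<Rightarrow> ('a \<Rightarrow> 'a) \<Rightarrow> ('a \<Rightarrow> 'a) \<Rightarrow> (nat \<Rightarrow> 'a) \<Rightarrow> (nat \<Rightarrow> 'a)" where
  "ore_x_times R \<sigma> \<delta> q =
     (\<lambda>n. (case n of 0 \<Rightarrow> \<zero>\<^bsub>R\<^esub> | Suc m \<Rightarrow> \<sigma> (q m)) \<oplus>\<^bsub>R\<^esub> \<delta> (q n))"

text \<open>
  The Ore extension R[x; \<sigma>, \<delta>] has the carrier, addition, monomials and coefficients of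
  the polynomials over R; only the product changes. The product of the sum of the p_i x^i
  with q is the sum of the p_i (x^i q). The lemmas below confirm that this is a
  ring in which x a = \<sigma>(a) x + \<delta>(a).
\<close>

definition ore_extension ::
    "('a, 'm) ring_scheme \<Rightarrow> ('a \<Rightarrow> 'a) \<Rightarrow> ('a \<Rightarrow> 'a) \<Rightarrow> ('a, nat \<Rightarrow> 'a) up_ring" where
  "ore_extension R \<sigma> \<delta> = (UP R)\<lparr> mult := (\<lambda>p\<in>up R. \<lambda>q\<in>up R.
     (\<Oplus>\<^bsub>UP R\<^esub>i\<in>{..deg R p}.
        coeff (UP R) p i \<odot>\<^bsub>UP R\<^esub> ((ore_x_times R \<sigma> \<delta> ^^ i) q))) \<rparr>"

definition condition_C :: "('a, 'm) ring_scheme \<Rightarrow> ('a \<Rightarrow> 'a) \<Rightarrow> bool" where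
  "condition_C R \<sigma> \<longleftrightarrow>
     (\<forall>a\<in>carrier R. \<forall>b\<in>carrier R. a \<otimes>\<^bsub>R\<^esub> \<sigma> b = \<zero>\<^bsub>R\<^esub> \<longrightarrow> a \<otimes>\<^bsub>R\<^esub> b = \<zero>\<^bsub>R\<^esub>)"

text \<open>
  The indices i, j range over all naturals; beyond the degrees the monomials are zero.
\<close>

definition skew_Armendariz ::
    "('a, 'm) ring_scheme \<Rightarrow> ('a \<Rightarrow> 'a) \<Rightarrow> ('a \<Rightarrow> 'a) \<Rightarrow> bool" where
  "skew_Armendariz R \<sigma> \<delta> \<longleftrightarrow>
     (let S = ore_extension R \<sigma> \<delta> in
      \<forall>p\<in>carrier S. \<forall>q\<in>carrier S. p \<otimes>\<^bsub>S\<^esub> q = \<zero>\<^bsub>S\<^esub> \<longrightarrow>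
        (\<forall>i j. monom S (coeff S p i) i \<otimes>\<^bsub>S\<^esub> monom S (coeff S q j) j = \<zero>\<^bsub>S\<^esub>))"

definition symmetric_ring :: "('a, 'm) ring_scheme \<Rightarrow> bool" where
  "symmetric_ring S \<longleftrightarrow>
     (\<forall>a\<in>carrier S. \<forall>b\<in>carrier S. \<forall>c\<in>carrier S.
        a \<otimes>\<^bsub>S\<^esub> b \<otimes>\<^bsub>S\<^esub> c = \<zero>\<^bsub>S\<^esub> \<longrightarrow> a \<otimes>\<^bsub>S\<^esub> c \<otimes>\<^bsub>S\<^esub> b = \<zero>\<^bsub>S\<^esub>)"

definition right_sigma_symmetric :: "('a, 'm) ring_scheme \<Rightarrow> ('a \<Rightarrow> 'a) \<Rightarrow> bool" where
  "right_sigma_symmetric R \<sigma> \<longleftrightarrow>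
     (\<forall>a\<in>carrier R. \<forall>b\<in>carrier R. \<forall>c\<in>carrier R.
        a \<otimes>\<^bsub>R\<^esub> b \<otimes>\<^bsub>R\<^esub> c = \<zero>\<^bsub>R\<^esub> \<longrightarrow> a \<otimes>\<^bsub>R\<^esub> c \<otimes>\<^bsub>R\<^esub> \<sigma> b = \<zero>\<^bsub>R\<^esub>)"

definition left_sigma_symmetric :: "('a, 'm) ring_scheme \<Rightarrow> ('a \<Rightarrow> 'a) \<Rightarrow> bool" where
  "left_sigma_symmetric R \<sigma> \<longleftrightarrow>
     (\<forall>a\<in>carrier R. \<forall>b\<in>carrier R. \<forall>c\<in>carrier R.
        a \<otimes>\<^bsub>R\<^esub> b \<otimes>\<^bsub>R\<^esub> c = \<zero>\<^bsub>R\<^esub> \<longrightarrow> \<sigma> b \<otimes>\<^bsub>R\<^esub> a \<otimes>\<^bsub>R\<^esub> c = \<zero>\<^bsub>R\<^esub>)"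

definition sigma_symmetric :: "('a, 'm) ring_scheme \<Rightarrow> ('a \<Rightarrow> 'a) \<Rightarrow> bool" where
  "sigma_symmetric R \<sigma> \<longleftrightarrow> right_sigma_symmetric R \<sigma> \<and> left_sigma_symmetric R \<sigma>"

locale ore_setup = UP_ring R P for R (structure) and P (structure) +
  fixes \<sigma> \<delta> :: "'a \<Rightarrow> 'a" and S and X
  assumes hom: "\<sigma> \<in> ring_hom R R"
    and der: "sigma_derivation R \<sigma> \<delta>"
  defines S_def: "S \<equiv> ore_extension R \<sigma> \<delta>"
    and X_def: "X \<equiv> ore_x_times R \<sigma> \<delta>"
begin

lemma \<sigma>_simps [simp]:
  "a \<in> carrier R \<Longrightarrow> \<sigma> a \<in> carrier R"
  "\<lbrakk>a \<in> carrier R; b \<in> carrier R\<rbrakk> \<Longrightarrow> \<sigma> (a \<otimes> b) = \<sigma> a \<otimes> \<sigma> b"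
  "\<lbrakk>a \<in> carrier R; b \<in> carrier R\<rbrakk> \<Longrightarrow> \<sigma> (a \<oplus> b) = \<sigma> a \<oplus> \<sigma> b"
  "\<sigma> \<one> = \<one>"
  using hom by (auto simp: ring_hom_def)

lemma \<delta>_simps [simp]:
  "a \<in> carrier R \<Longrightarrow> \<delta> a \<in> carrier R"
  "\<lbrakk>a \<in> carrier R; b \<in> carrier R\<rbrakk> \<Longrightarrow> \<delta> (a \<otimes> b) = \<sigma> a \<otimes> \<delta> b \<oplus> \<delta> a \<otimes> b"
  "\<lbrakk>a \<in> carrier R; b \<in> carrier R\<rbrakk> \<Longrightarrow> \<delta> (a \<oplus> b) = \<delta> a \<oplus> \<delta> b"
  using der by (auto simp: sigma_derivation_def)

lemma \<sigma>_zero [simp]: "\<sigma> \<zero> = \<zero>"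
proof -
  have "\<sigma> \<zero> \<oplus> \<sigma> \<zero> = \<sigma> \<zero> \<oplus> \<zero>"
    using \<sigma>_simps(3)[of \<zero> \<zero>] by simp
  then show ?thesis by (simp del: R.r_zero)
qed

lemma \<delta>_zero [simp]: "\<delta> \<zero> = \<zero>"
proof -
  have "\<delta> \<zero> \<oplus> \<delta> \<zero> = \<delta> \<zero> \<oplus> \<zero>"
    using \<delta>_simps(3)[of \<zero> \<zero>] by simp
  then show ?thesis by (simp del: R.r_zero)
qed

lemma \<delta>_one [simp]: "\<delta> \<one> = \<zero>"
proof -
  have "\<delta> \<one> \<oplus> \<delta> \<one> = \<delta> \<one> \<oplus> \<zero>"
    using \<delta>_simps(2)[of \<one> \<one>] by simp
  then show ?thesis by (simp del: R.r_zero)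
qed

lemma P_sel:
  "carrier P = up R" "p \<in> carrier P \<Longrightarrow> coeff P p n = p n"
  by (auto simp: P_def UP_def)

lemma X_closed [simp]:
  assumes "q \<in> carrier P" shows "X q \<in> carrier P"
proof -
  have q: "q n \<in> carrier R" for n
    using assms by (auto simp: P_sel)
  obtain N where N: "bound \<zero> N q" using assms by (auto simp: P_sel)
  have "bound \<zero> (Suc N) (X q)"
    using N by (auto simp: bound_def X_def ore_x_times_def split: nat.split)
  moreover have "X q n \<in> carrier R" for n
    using q by (simp add: X_def ore_x_times_def split: nat.split)
  ultimately show ?thesis
    by (auto simp only: P_sel(1))
qed

lemma coeff_X [simp]:
  "q \<in> carrier P \<Longrightarrow> coeff P (X q) n =
     (case n of 0 \<Rightarrow> \<zero> | Suc m \<Rightarrow> \<sigma> (coeff P q m)) \<oplus> \<delta> (coeff P q n)"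
  by (cases n) (simp_all add: P_sel(2)[OF X_closed] P_sel(2), simp_all add: X_def ore_x_times_def)

lemma X_add [simp]:
  "\<lbrakk>p \<in> carrier P; q \<in> carrier P\<rbrakk> \<Longrightarrow> X (p \<oplus>\<^bsub>P\<^esub> q) = X p \<oplus>\<^bsub>P\<^esub> X q"
  by (rule up_eqI) (auto simp: R.a_ac split: nat.split)

lemma X_smult:
  "\<lbrakk>a \<in> carrier R; q \<in> carrier P\<rbrakk> \<Longrightarrow> X (a \<odot>\<^bsub>P\<^esub> q) = \<sigma> a \<odot>\<^bsub>P\<^esub> X q \<oplus>\<^bsub>P\<^esub> \<delta> a \<odot>\<^bsub>P\<^esub> q"
  by (rule up_eqI) (auto simp: R.r_distr R.a_ac split: nat.split)

lemma X_zero [simp]: "X \<zero>\<^bsub>P\<^esub> = \<zero>\<^bsub>P\<^esub>"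
  by (rule up_eqI) (auto split: nat.split)

lemma Xn_closed [simp]: "q \<in> carrier P \<Longrightarrow> (X ^^ n) q \<in> carrier P"
  by (induct n) auto

lemma Xn_add [simp]:
  "\<lbrakk>p \<in> carrier P; q \<in> carrier P\<rbrakk> \<Longrightarrow> (X ^^ n) (p \<oplus>\<^bsub>P\<^esub> q) = (X ^^ n) p \<oplus>\<^bsub>P\<^esub> (X ^^ n) q"
  by (induct n) auto

lemma X_finsum:
  "finite A \<Longrightarrow> f \<in> A \<rightarrow> carrier P \<Longrightarrow> X (finsum P f A) = (\<Oplus>\<^bsub>P\<^esub>i\<in>A. X (f i))"
  by (induct rule: finite_induct) (auto simp: Pi_def)

lemma Xn_one: "(X ^^ n) \<one>\<^bsub>P\<^esub> = monom P \<one> n"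
proof (induct n)
  case 0 show ?case by (rule up_eqI) auto
next
  case (Suc n)
  have "X (monom P \<one> n) = monom P \<one> (Suc n)"
    by (rule up_eqI) (auto split: nat.split)
  with Suc show ?case by simp
qed

lemma S_sel:
  "carrier S = carrier P" "\<zero>\<^bsub>S\<^esub> = \<zero>\<^bsub>P\<^esub>" "\<one>\<^bsub>S\<^esub> = \<one>\<^bsub>P\<^esub>" "(\<oplus>\<^bsub>S\<^esub>) = (\<oplus>\<^bsub>P\<^esub>)"
  "monom S = monom P" "coeff S = coeff P"
  by (auto simp: S_def ore_extension_def P_def)

lemma S_mult_le:
  assumes "p \<in> carrier P" "q \<in> carrier P" "deg R p \<le> N"
  shows "p \<otimes>\<^bsub>S\<^esub> q = (\<Oplus>\<^bsub>P\<^esub>i\<in>{..N}. coeff P p i \<odot>\<^bsub>P\<^esub> (X ^^ i) q)"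
proof -
  have "p \<otimes>\<^bsub>S\<^esub> q = (\<Oplus>\<^bsub>P\<^esub>i\<in>{..deg R p}. coeff P p i \<odot>\<^bsub>P\<^esub> (X ^^ i) q)"
    using assms by (simp add: S_def ore_extension_def X_def P_def UP_def[of R, THEN arg_cong[of _ _ carrier]])
  also have "\<dots> = (\<Oplus>\<^bsub>P\<^esub>i\<in>{..N}. coeff P p i \<odot>\<^bsub>P\<^esub> (X ^^ i) q)"
    using assms by (intro P.add.finprod_mono_neutral_cong_left) (auto simp: deg_aboveD)
  finally show ?thesis .
qed

lemma S_mult_closed: "\<lbrakk>p \<in> carrier P; q \<in> carrier P\<rbrakk> \<Longrightarrow> p \<otimes>\<^bsub>S\<^esub> q \<in> carrier P"
  by (simp add: S_mult_le[OF _ _ order_refl] Pi_def)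

lemma S_l_distr:
  assumes "p \<in> carrier P" "q \<in> carrier P" "r \<in> carrier P"
  shows "(p \<oplus>\<^bsub>P\<^esub> q) \<otimes>\<^bsub>S\<^esub> r = p \<otimes>\<^bsub>S\<^esub> r \<oplus>\<^bsub>P\<^esub> q \<otimes>\<^bsub>S\<^esub> r"
proof -
  let ?N = "max (deg R p) (deg R q)"
  have "(p \<oplus>\<^bsub>P\<^esub> q) \<otimes>\<^bsub>S\<^esub> r = (\<Oplus>\<^bsub>P\<^esub>i\<in>{..?N}. coeff P (p \<oplus>\<^bsub>P\<^esub> q) i \<odot>\<^bsub>P\<^esub> (X ^^ i) r)"
    using assms by (intro S_mult_le) auto
  also have "\<dots> = (\<Oplus>\<^bsub>P\<^esub>i\<in>{..?N}. coeff P p i \<odot>\<^bsub>P\<^esub> (X ^^ i) r \<oplus>\<^bsub>P\<^esub> coeff P q i \<odot>\<^bsub>P\<^esub> (X ^^ i) r)"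
    using assms by (simp add: UP_smult_l_distr cong: P.finsum_cong)
  also have "\<dots> = p \<otimes>\<^bsub>S\<^esub> r \<oplus>\<^bsub>P\<^esub> q \<otimes>\<^bsub>S\<^esub> r"
    using assms by (simp add: P.finsum_addf Pi_def S_mult_le[of _ _ ?N])
  finally show ?thesis .
qed

lemma S_r_distr:
  assumes "p \<in> carrier P" "q \<in> carrier P" "r \<in> carrier P"
  shows "r \<otimes>\<^bsub>S\<^esub> (p \<oplus>\<^bsub>P\<^esub> q) = r \<otimes>\<^bsub>S\<^esub> p \<oplus>\<^bsub>P\<^esub> r \<otimes>\<^bsub>S\<^esub> q"
  using assms
  by (simp add: S_mult_le[OF _ _ order_refl] UP_smult_r_distr P.finsum_addf Pi_def cong: P.finsum_cong)

lemma smult_finsum: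
  "finite A \<Longrightarrow> a \<in> carrier R \<Longrightarrow> f \<in> A \<rightarrow> carrier P \<Longrightarrow>
     a \<odot>\<^bsub>P\<^esub> finsum P f A = (\<Oplus>\<^bsub>P\<^esub>i\<in>A. a \<odot>\<^bsub>P\<^esub> f i)"
proof (induct rule: finite_induct)
  case empty
  then show ?case by (auto intro: up_eqI)
qed (auto simp: Pi_def UP_smult_r_distr)

lemma smult_S_mult:
  assumes "a \<in> carrier R" "p \<in> carrier P" "q \<in> carrier P"
  shows "(a \<odot>\<^bsub>P\<^esub> p) \<otimes>\<^bsub>S\<^esub> q = a \<odot>\<^bsub>P\<^esub> (p \<otimes>\<^bsub>S\<^esub> q)"
proof -
  have "deg R (a \<odot>\<^bsub>P\<^esub> p) \<le> deg R p"
    using assms by (intro deg_aboveI) (auto simp: deg_aboveD)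
  then show ?thesis
    using assms
    by (simp add: S_mult_le[of _ _ "deg R p"] smult_finsum Pi_def UP_smult_assoc1 cong: P.finsum_cong)
qed

lemma finsum_S_mult:
  "finite A \<Longrightarrow> f \<in> A \<rightarrow> carrier P \<Longrightarrow> q \<in> carrier P \<Longrightarrow>
     finsum P f A \<otimes>\<^bsub>S\<^esub> q = (\<Oplus>\<^bsub>P\<^esub>i\<in>A. f i \<otimes>\<^bsub>S\<^esub> q)"
proof (induct rule: finite_induct)
  case empty
  then show ?case by (simp add: S_mult_le[OF _ _ order_refl])
next
  case (insert x F)
  then show ?case by (simp add: Pi_def S_l_distr S_mult_closed)
qed

lemma X_S_mult:
  assumes "q \<in> carrier P" "r \<in> carrier P"
  shows "X q \<otimes>\<^bsub>S\<^esub> r = X (q \<otimes>\<^bsub>S\<^esub> r)"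
proof -
  let ?N = "deg R q"
  let ?Y = "\<lambda>i. (X ^^ i) r"
  have d: "deg R (X q) \<le> Suc ?N"
    using assms by (intro deg_aboveI) (auto simp: deg_aboveD split: nat.split)
  have "X (q \<otimes>\<^bsub>S\<^esub> r) = (\<Oplus>\<^bsub>P\<^esub>i\<in>{..?N}. X (coeff P q i \<odot>\<^bsub>P\<^esub> ?Y i))"
    using assms by (simp add: S_mult_le[of _ _ ?N] X_finsum Pi_def)
  also have "\<dots> = (\<Oplus>\<^bsub>P\<^esub>i\<in>{..?N}. \<sigma> (coeff P q i) \<odot>\<^bsub>P\<^esub> ?Y (Suc i))
      \<oplus>\<^bsub>P\<^esub> (\<Oplus>\<^bsub>P\<^esub>i\<in>{..?N}. \<delta> (coeff P q i) \<odot>\<^bsub>P\<^esub> ?Y i)"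
    using assms by (simp add: X_smult P.finsum_addf Pi_def cong: P.finsum_cong)
  also have "(\<Oplus>\<^bsub>P\<^esub>i\<in>{..?N}. \<delta> (coeff P q i) \<odot>\<^bsub>P\<^esub> ?Y i)
      = (\<Oplus>\<^bsub>P\<^esub>i\<in>{..Suc ?N}. \<delta> (coeff P q i) \<odot>\<^bsub>P\<^esub> ?Y i)"
    using assms by (intro P.add.finprod_mono_neutral_cong_left) (auto simp: deg_aboveD simp del: funpow.simps)
  also have "(\<Oplus>\<^bsub>P\<^esub>i\<in>{..?N}. \<sigma> (coeff P q i) \<odot>\<^bsub>P\<^esub> ?Y (Suc i))
      = (\<Oplus>\<^bsub>P\<^esub>i\<in>{..Suc ?N}. (case i of 0 \<Rightarrow> \<zero> | Suc m \<Rightarrow> \<sigma> (coeff P q m)) \<odot>\<^bsub>P\<^esub> ?Y i)"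
    using assms by (subst P.finsum_Suc2) (auto simp: Pi_def split: nat.split simp del: funpow.simps)
  also have "\<dots> \<oplus>\<^bsub>P\<^esub> (\<Oplus>\<^bsub>P\<^esub>i\<in>{..Suc ?N}. \<delta> (coeff P q i) \<odot>\<^bsub>P\<^esub> ?Y i)
      = (\<Oplus>\<^bsub>P\<^esub>i\<in>{..Suc ?N}. (case i of 0 \<Rightarrow> \<zero> | Suc m \<Rightarrow> \<sigma> (coeff P q m)) \<odot>\<^bsub>P\<^esub> ?Y i
          \<oplus>\<^bsub>P\<^esub> \<delta> (coeff P q i) \<odot>\<^bsub>P\<^esub> ?Y i)"
    using assms by (subst P.finsum_addf) (auto simp: Pi_def split: nat.split simp del: funpow.simps)
  also have "\<dots> = (\<Oplus>\<^bsub>P\<^esub>i\<in>{..Suc ?N}. coeff P (X q) i \<odot>\<^bsub>P\<^esub> ?Y i)"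
    using assms
    by (intro P.finsum_cong') (auto simp: UP_smult_l_distr split: nat.split simp del: funpow.simps)
  also have "\<dots> = X q \<otimes>\<^bsub>S\<^esub> r"
    using assms d by (simp only: S_mult_le[OF X_closed])
  finally show ?thesis by simp
qed

lemma Xn_S_mult:
  "\<lbrakk>q \<in> carrier P; r \<in> carrier P\<rbrakk> \<Longrightarrow> (X ^^ n) q \<otimes>\<^bsub>S\<^esub> r = (X ^^ n) (q \<otimes>\<^bsub>S\<^esub> r)"
  by (induct n) (simp_all add: X_S_mult)

lemma S_assoc:
  assumes "p \<in> carrier P" "q \<in> carrier P" "r \<in> carrier P"
  shows "(p \<otimes>\<^bsub>S\<^esub> q) \<otimes>\<^bsub>S\<^esub> r = p \<otimes>\<^bsub>S\<^esub> (q \<otimes>\<^bsub>S\<^esub> r)"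
  using assms
  by (simp add: S_mult_le[of p _ "deg R p"] finsum_S_mult Pi_def smult_S_mult Xn_S_mult
        S_mult_closed cong: P.finsum_cong)

lemma S_l_one: "p \<in> carrier P \<Longrightarrow> \<one>\<^bsub>P\<^esub> \<otimes>\<^bsub>S\<^esub> p = p"
  by (simp add: S_mult_le[of _ _ 0])

lemma S_r_one: "p \<in> carrier P \<Longrightarrow> p \<otimes>\<^bsub>S\<^esub> \<one>\<^bsub>P\<^esub> = p"
  using up_repr[of p]
  by (simp add: S_mult_le[OF _ _ order_refl] Xn_one monom_mult_smult[symmetric] del: monom_mult
        cong: P.finsum_cong)

lemma ring_S: "ring S"
proof (rule ringI)
  show "abelian_group S"
    by (rule abelian_groupI) (auto simp: S_sel P.a_ac UP_l_neg_ex)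
  show "monoid S"
    by (rule monoidI) (simp_all add: S_sel S_mult_closed S_assoc S_l_one S_r_one)
qed (simp_all add: S_sel S_l_distr S_r_distr)

lemma S_x_mult:
  assumes "a \<in> carrier R"
  shows "monom S \<one> 1 \<otimes>\<^bsub>S\<^esub> monom S a 0 = monom S (\<sigma> a) 1 \<oplus>\<^bsub>S\<^esub> monom S (\<delta> a) 0"
proof -
  have "monom P \<one> 1 \<otimes>\<^bsub>S\<^esub> monom P a 0 = X (monom P a 0)"
    using assms by (simp add: S_mult_le[of _ _ 1] deg_monom_le del: One_nat_def) (simp add: atMost_Suc)
  also have "\<dots> = monom P (\<sigma> a) 1 \<oplus>\<^bsub>P\<^esub> monom P (\<delta> a) 0"
    using assms by (intro up_eqI) (auto split: nat.split)
  finally show ?thesis by (simp add: S_sel)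
qed

lemma S_monom_mult:
  assumes "a \<in> carrier R" "b \<in> carrier R"
  shows "monom S a 0 \<otimes>\<^bsub>S\<^esub> monom S b n = a \<odot>\<^bsub>S\<^esub> monom S b n"
  using assms
  by (simp add: S_sel S_mult_le[of _ _ 0]) (simp add: S_def ore_extension_def P_def)

end

theorem ring_ore_extension:
  "\<lbrakk>ring R; \<sigma> \<in> ring_hom R R; sigma_derivation R \<sigma> \<delta>\<rbrakk> \<Longrightarrow> ring (ore_extension R \<sigma> \<delta>)"
  by (intro ore_setup.ring_S ore_setup.intro ore_setup_axioms.intro UP_ring.intro)

end

theory Submission
  imports Defs
begin

text \<open>
  On the level of \<open>R\<close>, symmetry is transported to products with \<open>\<sigma> b\<close> by one observation: in a
  reversible ring (\<open>a b = 0\<close> implies \<open>b a = 0\<close>; take one of the three factors of the symmetry law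
  to be \<open>1\<close>), \<open>a b = 0\<close> gives \<open>\<sigma> b \<sigma> a = 0\<close>, hence \<open>\<sigma> b a = 0\<close> by the condition
  \<open>C\<^sub>\<sigma>\<close>, hence \<open>a \<sigma> b = 0\<close>. Conversely \<open>C\<^sub>\<sigma>\<close> removes \<open>\<sigma>\<close> on the right. So the three
  conditions on \<open>R\<close> are equivalent.

  The passage to the Ore extension \<open>S\<close> reduces vanishing of products in \<open>S\<close> to vanishing of products
  of coefficients: when \<open>R\<close> is symmetric, \<open>p q = 0\<close> if and only if \<open>p\<^sub>i q\<^sub>j = 0\<close> for all
  \<open>i, j\<close>. From left to right, the
  Armendariz property gives \<open>p\<^sub>i x\<^sup>i q\<^sub>j x\<^sup>j = 0\<close>, whose leading coefficient is
  \<open>p\<^sub>i \<sigma>\<^sup>i(q\<^sub>j)\<close>, and \<open>C\<^sub>\<sigma>\<close> strips off the powers of \<open>\<sigma>\<close>. From right to left, one needs that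
  the right annihilator of an element of \<open>R\<close> is closed under \<open>\<sigma>\<close>, as above, and under
  \<open>\<delta>\<close>: if \<open>b a = 0\<close>, then \<open>(\<sigma>(b) x + \<delta>(b)) a = x b a = 0\<close>, so the Armendariz property
  splits off \<open>\<delta>(b) a = 0\<close>, and \<open>a \<delta>(b) = 0\<close> by reversibility.

  Applying this criterion twice, once to \<open>p\<close> and \<open>q r\<close> and then to \<open>p\<^sub>i q\<close> and \<open>r\<close>, shows that
  \<open>p q r = 0\<close> if and only if \<open>p\<^sub>i q\<^sub>j r\<^sub>k = 0\<close> for all \<open>i, j, k\<close>, and the latter condition is
  unchanged by exchanging \<open>q\<close> and \<open>r\<close>. Conversely \<open>R\<close> is a subring of \<open>S\<close>.
\<close>

section \<open>Symmetric and sigma-symmetric rings\<close>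

lemma symmetric_ring_imp_reversible:
  assumes "ring R" "symmetric_ring R"
    and "a \<in> carrier R" "b \<in> carrier R" "a \<otimes>\<^bsub>R\<^esub> b = \<zero>\<^bsub>R\<^esub>"
  shows "b \<otimes>\<^bsub>R\<^esub> a = \<zero>\<^bsub>R\<^esub>"
proof -
  interpret ring R by fact
  have "\<one>\<^bsub>R\<^esub> \<otimes>\<^bsub>R\<^esub> a \<otimes>\<^bsub>R\<^esub> b = \<zero>\<^bsub>R\<^esub>"
    using assms by simp
  then have "\<one>\<^bsub>R\<^esub> \<otimes>\<^bsub>R\<^esub> b \<otimes>\<^bsub>R\<^esub> a = \<zero>\<^bsub>R\<^esub>"
    using assms unfolding symmetric_ring_def by blast
  then show ?thesis
    using assms by simp
qed

text \<open>
  The condition \<open>C\<^sub>\<sigma>\<close> only removes an application of \<open>\<sigma>\<close>. To introduce one, apply \<open>\<sigma>\<close> to both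
  factors of \<open>b a = 0\<close> and then remove it from the right one.
\<close>

lemma symmetric_ring_imp_annihilates_endo:
  assumes "ring R" "\<sigma> \<in> ring_hom R R" "condition_C R \<sigma>" "symmetric_ring R"
    and ab: "a \<in> carrier R" "b \<in> carrier R" "a \<otimes>\<^bsub>R\<^esub> b = \<zero>\<^bsub>R\<^esub>"
  shows "a \<otimes>\<^bsub>R\<^esub> \<sigma> b = \<zero>\<^bsub>R\<^esub>"
proof -
  note reversible = symmetric_ring_imp_reversible[OF assms(1,4)]
  have \<sigma>b: "\<sigma> b \<in> carrier R"
    using assms(2) ab(2) by (rule ring_hom_closed)
  have "\<sigma> b \<otimes>\<^bsub>R\<^esub> \<sigma> a = \<sigma> (b \<otimes>\<^bsub>R\<^esub> a)"
    using assms(2) ab by (simp add: ring_hom_mult)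
  also have "\<dots> = \<zero>\<^bsub>R\<^esub>"
    using reversible[OF ab] ring_hom_zero[OF assms(2,1,1)] by simp
  finally have "\<sigma> b \<otimes>\<^bsub>R\<^esub> a = \<zero>\<^bsub>R\<^esub>"
    using assms(3) \<sigma>b ab(1) unfolding condition_C_def by blast
  with \<sigma>b ab(1) show ?thesis
    by (rule reversible)
qed

lemma symmetric_ring_imp_right_sigma_symmetric:
  assumes "ring R" "\<sigma> \<in> ring_hom R R" "condition_C R \<sigma>" "symmetric_ring R"
  shows "right_sigma_symmetric R \<sigma>"
  unfolding right_sigma_symmetric_def
proof (intro ballI impI)
  interpret ring R by fact
  fix a b c
  assume abc: "a \<in> carrier R" "b \<in> carrier R" "c \<in> carrier R" "a \<otimes>\<^bsub>R\<^esub> b \<otimes>\<^bsub>R\<^esub> c = \<zero>\<^bsub>R\<^esub>"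
  then have "a \<otimes>\<^bsub>R\<^esub> c \<otimes>\<^bsub>R\<^esub> b = \<zero>\<^bsub>R\<^esub>"
    using assms(4) unfolding symmetric_ring_def by blast
  with abc show "a \<otimes>\<^bsub>R\<^esub> c \<otimes>\<^bsub>R\<^esub> \<sigma> b = \<zero>\<^bsub>R\<^esub>"
    by (intro symmetric_ring_imp_annihilates_endo[OF assms]) auto
qed

lemma right_sigma_symmetric_imp_symmetric_ring:
  assumes "ring R" "condition_C R \<sigma>" "right_sigma_symmetric R \<sigma>"
  shows "symmetric_ring R"
  unfolding symmetric_ring_def
proof (intro ballI impI)
  interpret ring R by fact
  fix a b c
  assume abc: "a \<in> carrier R" "b \<in> carrier R" "c \<in> carrier R" "a \<otimes>\<^bsub>R\<^esub> b \<otimes>\<^bsub>R\<^esub> c = \<zero>\<^bsub>R\<^esub>"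
  then have "a \<otimes>\<^bsub>R\<^esub> c \<otimes>\<^bsub>R\<^esub> \<sigma> b = \<zero>\<^bsub>R\<^esub>"
    using assms(3) unfolding right_sigma_symmetric_def by blast
  then show "a \<otimes>\<^bsub>R\<^esub> c \<otimes>\<^bsub>R\<^esub> b = \<zero>\<^bsub>R\<^esub>"
    using assms(2) abc m_closed[of a c] unfolding condition_C_def by blast
qed

text \<open>
  The left-hand condition follows from the right-hand one because \<open>\<sigma> b\<close> can be moved from the
  right end of a vanishing product to its left end by reversibility.
\<close>

lemma symmetric_ring_imp_left_sigma_symmetric:
  assumes "ring R" "\<sigma> \<in> ring_hom R R" "condition_C R \<sigma>" "symmetric_ring R"
  shows "left_sigma_symmetric R \<sigma>"
  unfolding left_sigma_symmetric_def
proof (intro ballI impI)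
  interpret ring R by fact
  fix a b c
  assume abc: "a \<in> carrier R" "b \<in> carrier R" "c \<in> carrier R" "a \<otimes>\<^bsub>R\<^esub> b \<otimes>\<^bsub>R\<^esub> c = \<zero>\<^bsub>R\<^esub>"
  have \<sigma>b: "\<sigma> b \<in> carrier R"
    using assms(2) abc(2) by (rule ring_hom_closed)
  have "a \<otimes>\<^bsub>R\<^esub> c \<otimes>\<^bsub>R\<^esub> \<sigma> b = \<zero>\<^bsub>R\<^esub>"
    using symmetric_ring_imp_right_sigma_symmetric[OF assms] abc
    unfolding right_sigma_symmetric_def by blast
  then have "\<sigma> b \<otimes>\<^bsub>R\<^esub> (a \<otimes>\<^bsub>R\<^esub> c) = \<zero>\<^bsub>R\<^esub>"
    using abc \<sigma>b symmetric_ring_imp_reversible[OF assms(1,4), of "a \<otimes>\<^bsub>R\<^esub> c" "\<sigma> b"] by simp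
  then show "\<sigma> b \<otimes>\<^bsub>R\<^esub> a \<otimes>\<^bsub>R\<^esub> c = \<zero>\<^bsub>R\<^esub>"
    using abc \<sigma>b by (simp add: m_assoc)
qed

section \<open>Vanishing products in the Ore extension\<close>

context ore_setup
begin

lemma const_S_mult:
  assumes "a \<in> carrier R" "q \<in> carrier P"
  shows "monom P a 0 \<otimes>\<^bsub>S\<^esub> q = a \<odot>\<^bsub>P\<^esub> q"
  using assms by (simp add: S_mult_le[of _ _ 0])

lemma const_S_mult_const:
  assumes "a \<in> carrier R" "b \<in> carrier R"
  shows "monom P a 0 \<otimes>\<^bsub>S\<^esub> monom P b 0 = monom P (a \<otimes> b) 0"
  using assms by (simp add: const_S_mult monom_mult_smult)

lemma monom_S_mult:
  assumes "a \<in> carrier R" "q \<in> carrier P"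
  shows "monom P a i \<otimes>\<^bsub>S\<^esub> q = a \<odot>\<^bsub>P\<^esub> (X ^^ i) q"
proof -
  have "monom P a i \<otimes>\<^bsub>S\<^esub> q = (\<Oplus>\<^bsub>P\<^esub>k\<in>{..i}. coeff P (monom P a i) k \<odot>\<^bsub>P\<^esub> (X ^^ k) q)"
    using assms by (intro S_mult_le) (auto simp: deg_monom_le)
  also have "\<dots> = (\<Oplus>\<^bsub>P\<^esub>k\<in>{..i}. if i = k then a \<odot>\<^bsub>P\<^esub> (X ^^ k) q else \<zero>\<^bsub>P\<^esub>)"
    using assms by (intro P.finsum_cong') auto
  also have "\<dots> = a \<odot>\<^bsub>P\<^esub> (X ^^ i) q"
    using assms by (intro P.add.finprod_singleton) auto
  finally show ?thesis .
qed

lemma smult_eq_zero_iff: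
  assumes "a \<in> carrier R" "q \<in> carrier P"
  shows "a \<odot>\<^bsub>P\<^esub> q = \<zero>\<^bsub>P\<^esub> \<longleftrightarrow> (\<forall>j. a \<otimes> coeff P q j = \<zero>)"
proof
  assume "a \<odot>\<^bsub>P\<^esub> q = \<zero>\<^bsub>P\<^esub>"
  then show "\<forall>j. a \<otimes> coeff P q j = \<zero>"
    using assms by (metis coeff_smult coeff_zero)
qed (use assms in \<open>auto intro: up_eqI\<close>)

lemma Xn_monom_coeff_above:
  assumes "b \<in> carrier R" "i + j < n"
  shows "coeff P ((X ^^ i) (monom P b j)) n = \<zero>"
  using assms(2)
proof (induct i arbitrary: n)
  case (Suc i)
  then show ?case using assms(1) by (cases n) auto
qed (use assms(1) in auto)

lemma Xn_monom_coeff_top: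
  assumes "b \<in> carrier R"
  shows "coeff P ((X ^^ i) (monom P b j)) (i + j) = (\<sigma> ^^ i) b"
proof (induct i)
  case (Suc i)
  have "(\<sigma> ^^ i) b \<in> carrier R" for i
    by (induct i) (use assms in auto)
  with Suc show ?case
    using assms Xn_monom_coeff_above[OF assms, of i j "Suc (i + j)"] by simp
qed (use assms in auto)

lemma condition_C_funpow:
  assumes "condition_C R \<sigma>" "a \<in> carrier R" "b \<in> carrier R" "a \<otimes> (\<sigma> ^^ i) b = \<zero>"
  shows "a \<otimes> b = \<zero>"
  using assms(4)
proof (induct i)
  case (Suc i)
  have "(\<sigma> ^^ i) b \<in> carrier R"
    by (induct i) (use assms(3) in auto)
  with Suc assms(1,2) show ?case
    unfolding condition_C_def by simp
qed simp

text \<open>The leading coefficient of \<open>p\<^sub>i x\<^sup>i q\<^sub>j x\<^sup>j\<close> is \<open>p\<^sub>i \<sigma>\<^sup>i(q\<^sub>j)\<close>.\<close>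

lemma skew_Armendariz_coeff_mult_eq_zero:
  assumes "skew_Armendariz R \<sigma> \<delta>" "condition_C R \<sigma>"
    and pq: "p \<in> carrier P" "q \<in> carrier P" "p \<otimes>\<^bsub>S\<^esub> q = \<zero>\<^bsub>P\<^esub>"
  shows "coeff P p i \<otimes> coeff P q j = \<zero>"
proof -
  let ?a = "coeff P p i" and ?b = "coeff P q j"
  have ab: "?a \<in> carrier R" "?b \<in> carrier R"
    using pq by auto
  have "monom P ?a i \<otimes>\<^bsub>S\<^esub> monom P ?b j = \<zero>\<^bsub>P\<^esub>"
    using assms(1) pq unfolding skew_Armendariz_def Let_def S_def[symmetric]
    by (simp add: S_sel)
  then have "?a \<odot>\<^bsub>P\<^esub> (X ^^ i) (monom P ?b j) = \<zero>\<^bsub>P\<^esub>"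
    using ab by (simp add: monom_S_mult)
  then have "?a \<otimes> coeff P ((X ^^ i) (monom P ?b j)) (i + j) = \<zero>"
    using ab by (simp add: smult_eq_zero_iff)
  then show ?thesis
    using ab assms(2) by (auto simp: Xn_monom_coeff_top intro: condition_C_funpow)
qed

text \<open>
  If \<open>b a = 0\<close>, then \<open>(x b) a = 0\<close> in the Ore extension, where \<open>x b = \<sigma>(b) x + \<delta>(b)\<close> has
  constant coefficient \<open>\<delta>(b)\<close>.
\<close>

lemma skew_Armendariz_derivation_annihilates:
  assumes "skew_Armendariz R \<sigma> \<delta>" "condition_C R \<sigma>"
    and ba: "b \<in> carrier R" "a \<in> carrier R" "b \<otimes> a = \<zero>"
  shows "\<delta> b \<otimes> a = \<zero>"
proof -
  have "X (monom P b 0) \<otimes>\<^bsub>S\<^esub> monom P a 0 = \<zero>\<^bsub>P\<^esub>"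
    using ba by (simp add: X_S_mult const_S_mult_const)
  from skew_Armendariz_coeff_mult_eq_zero[OF assms(1,2) _ _ this, of 0 0]
  show ?thesis
    using ba by simp
qed

end

section \<open>Transfer of symmetry to the Ore extension\<close>

locale symmetric_skew_Armendariz = ore_setup +
  assumes Armendariz: "skew_Armendariz R \<sigma> \<delta>"
    and cond_C: "condition_C R \<sigma>"
    and symmetric: "symmetric_ring R"
begin

lemma annihilates_sigma:
  assumes "a \<in> carrier R" "b \<in> carrier R" "a \<otimes> b = \<zero>"
  shows "a \<otimes> \<sigma> b = \<zero>"
  using symmetric_ring_imp_annihilates_endo[OF R.ring_axioms hom cond_C symmetric assms] .

lemma annihilates_delta:
  assumes "a \<in> carrier R" "b \<in> carrier R" "a \<otimes> b = \<zero>"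
  shows "a \<otimes> \<delta> b = \<zero>"
proof -
  note reversible = symmetric_ring_imp_reversible[OF R.ring_axioms symmetric]
  have "\<delta> b \<otimes> a = \<zero>"
    using assms reversible[OF assms]
    by (intro skew_Armendariz_derivation_annihilates[OF Armendariz cond_C])
  with assms show ?thesis
    using reversible[of "\<delta> b" a] by simp
qed

text \<open>
  The coefficients of \<open>x q\<close> are sums of values of \<open>\<sigma>\<close> and \<open>\<delta>\<close> at coefficients of \<open>q\<close>, so
  left multiplication by \<open>x\<close> preserves annihilation by \<open>a\<close>.
\<close>

lemma smult_Xn_eq_zero:
  assumes "a \<in> carrier R" "q \<in> carrier P" "a \<odot>\<^bsub>P\<^esub> q = \<zero>\<^bsub>P\<^esub>"
  shows "a \<odot>\<^bsub>P\<^esub> (X ^^ i) q = \<zero>\<^bsub>P\<^esub>"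
proof (induct i)
  case (Suc i)
  have "a \<otimes> coeff P ((X ^^ i) q) j = \<zero>" for j
    using Suc assms by (simp add: smult_eq_zero_iff)
  then show ?case
    using assms
    by (auto simp: smult_eq_zero_iff R.r_distr annihilates_sigma annihilates_delta split: nat.split)
qed (use assms in simp)

lemma S_mult_eq_zero_iff_smult:
  assumes "p \<in> carrier P" "q \<in> carrier P"
  shows "p \<otimes>\<^bsub>S\<^esub> q = \<zero>\<^bsub>P\<^esub> \<longleftrightarrow> (\<forall>i. coeff P p i \<odot>\<^bsub>P\<^esub> q = \<zero>\<^bsub>P\<^esub>)"
proof
  assume "p \<otimes>\<^bsub>S\<^esub> q = \<zero>\<^bsub>P\<^esub>"
  with assms show "\<forall>i. coeff P p i \<odot>\<^bsub>P\<^esub> q = \<zero>\<^bsub>P\<^esub>"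
    by (simp add: smult_eq_zero_iff skew_Armendariz_coeff_mult_eq_zero[OF Armendariz cond_C])
next
  assume "\<forall>i. coeff P p i \<odot>\<^bsub>P\<^esub> q = \<zero>\<^bsub>P\<^esub>"
  with assms show "p \<otimes>\<^bsub>S\<^esub> q = \<zero>\<^bsub>P\<^esub>"
    by (simp add: S_mult_le[OF _ _ order_refl] smult_Xn_eq_zero cong: P.finsum_cong)
qed

text \<open>
  Associativity in the form \<open>p\<^sub>i (q r) = (p\<^sub>i q) r\<close> lets the criterion for two factors be applied
  a second time, since the coefficients of \<open>p\<^sub>i q\<close> are just \<open>p\<^sub>i q\<^sub>j\<close>.
\<close>

lemma S_mult_mult_eq_zero_iff:
  assumes "p \<in> carrier P" "q \<in> carrier P" "r \<in> carrier P"
  shows "p \<otimes>\<^bsub>S\<^esub> q \<otimes>\<^bsub>S\<^esub> r = \<zero>\<^bsub>P\<^esub> \<longleftrightarrow>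
    (\<forall>i j k. coeff P p i \<otimes> coeff P q j \<otimes> coeff P r k = \<zero>)"
proof -
  have "p \<otimes>\<^bsub>S\<^esub> q \<otimes>\<^bsub>S\<^esub> r = \<zero>\<^bsub>P\<^esub> \<longleftrightarrow> (\<forall>i. coeff P p i \<odot>\<^bsub>P\<^esub> (q \<otimes>\<^bsub>S\<^esub> r) = \<zero>\<^bsub>P\<^esub>)"
    using assms by (simp add: S_assoc S_mult_closed S_mult_eq_zero_iff_smult)
  also have "\<dots> \<longleftrightarrow> (\<forall>i. (coeff P p i \<odot>\<^bsub>P\<^esub> q) \<otimes>\<^bsub>S\<^esub> r = \<zero>\<^bsub>P\<^esub>)"
    using assms by (simp add: smult_S_mult)
  also have "\<dots> \<longleftrightarrow> (\<forall>i j k. coeff P p i \<otimes> coeff P q j \<otimes> coeff P r k = \<zero>)"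
    using assms by (simp add: S_mult_eq_zero_iff_smult smult_eq_zero_iff)
  finally show ?thesis .
qed

lemma symmetric_ring_S: "symmetric_ring S"
  unfolding symmetric_ring_def S_sel
proof (intro ballI impI)
  fix p q r
  assume pqr: "p \<in> carrier P" "q \<in> carrier P" "r \<in> carrier P" "p \<otimes>\<^bsub>S\<^esub> q \<otimes>\<^bsub>S\<^esub> r = \<zero>\<^bsub>P\<^esub>"
  then have "coeff P p i \<otimes> coeff P q j \<otimes> coeff P r k = \<zero>" for i j k
    by (simp add: S_mult_mult_eq_zero_iff)
  then have "coeff P p i \<otimes> coeff P r k \<otimes> coeff P q j = \<zero>" for i j k
    using symmetric pqr unfolding symmetric_ring_def by simp
  then show "p \<otimes>\<^bsub>S\<^esub> r \<otimes>\<^bsub>S\<^esub> q = \<zero>\<^bsub>P\<^esub>"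
    using pqr by (simp add: S_mult_mult_eq_zero_iff)
qed

end

lemma (in ore_setup) symmetric_ring_if_symmetric_ring_S:
  assumes "symmetric_ring S"
  shows "symmetric_ring R"
  unfolding symmetric_ring_def
proof (intro ballI impI)
  fix a b c
  assume abc: "a \<in> carrier R" "b \<in> carrier R" "c \<in> carrier R" "a \<otimes> b \<otimes> c = \<zero>"
  let ?C = "\<lambda>a. monom P a 0"
  have "?C a \<otimes>\<^bsub>S\<^esub> ?C b \<otimes>\<^bsub>S\<^esub> ?C c = \<zero>\<^bsub>P\<^esub>"
    using abc by (simp add: const_S_mult_const)
  then have "?C a \<otimes>\<^bsub>S\<^esub> ?C c \<otimes>\<^bsub>S\<^esub> ?C b = \<zero>\<^bsub>P\<^esub>"
    using assms abc unfolding symmetric_ring_def by (simp add: S_sel)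
  then have "coeff P (?C (a \<otimes> c \<otimes> b)) 0 = coeff P \<zero>\<^bsub>P\<^esub> 0"
    using abc by (simp add: const_S_mult_const)
  then show "a \<otimes> c \<otimes> b = \<zero>"
    using abc by simp
qed

theorem theorem3p4:
  fixes R :: "('a, 'm) ring_scheme" and \<sigma> \<delta> :: "'a \<Rightarrow> 'a"
  assumes "ring R"
    and "\<sigma> \<in> ring_hom R R"
    and "sigma_derivation R \<sigma> \<delta>"
    and "skew_Armendariz R \<sigma> \<delta>"
    and "condition_C R \<sigma>"
  shows "(symmetric_ring R \<longleftrightarrow> sigma_symmetric R \<sigma>) \<and>
         (sigma_symmetric R \<sigma> \<longleftrightarrow> right_sigma_symmetric R \<sigma>) \<and>
         (right_sigma_symmetric R \<sigma> \<longleftrightarrow> symmetric_ring (ore_extension R \<sigma> \<delta>))"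
proof -
  interpret ore_setup R "UP R" \<sigma> \<delta> "ore_extension R \<sigma> \<delta>" "ore_x_times R \<sigma> \<delta>"
    using assms(1-3) by (intro ore_setup.intro ore_setup_axioms.intro UP_ring.intro)
  note R = assms(1,2,5)
  have "symmetric_ring (ore_extension R \<sigma> \<delta>)" if "symmetric_ring R"
  proof -
    interpret symmetric_skew_Armendariz R "UP R" \<sigma> \<delta>
        "ore_extension R \<sigma> \<delta>" "ore_x_times R \<sigma> \<delta>"
      by unfold_locales (use assms(4,5) that in auto)
    show ?thesis
      by (rule symmetric_ring_S)
  qed
  then show ?thesis
    using symmetric_ring_imp_right_sigma_symmetric[OF R]
      symmetric_ring_imp_left_sigma_symmetric[OF R]
      right_sigma_symmetric_imp_symmetric_ring[OF assms(1,5)]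
      symmetric_ring_if_symmetric_ring_S
    unfolding sigma_symmetric_def by blast
qed

end
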